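(* Let $G$ be a split graph with a fixed partition of $V(G)$ into a clique $C(G)$ and an independent set $I(G)$, and let $P$ be the characteristic poset of $G$. Then $\dim(P)\le t(\overline{G})$, where $\overline{G}$ is the complement of $G$.
   Context: All graphs are finite, simple and undirected; $N(u,G)$ denotes the set of neighbours of $u$ in $G$. A split graph is a graph whose vertex set can be partitioned into a clique and an independent set. The characteristic poset of the split graph $G$ (with respect to the partition $C(G),I(G)$) is $P=(\mathcal{S}(G),\subseteq)$ where $\mathcal{S}(G)=\{N(u,G): u\in I(G)\}$, ordered by set inclusion. A threshold graph is a graph $G=(V,E)$ admitting a real $S$ and $w:V\to\mathbb{R}$ with $uv\in E$ iff $w(u)+w(v)\ge S$ (for distinct $u,v$). The threshold dimension $t(G)$ is the least $k$ such that there are threshold graphs $G_1,\dots,G_k$ on $V(G)$ with $E(G)=\bigcup_i E(G_i)$. For a poset $P=(S,\le_P)$, a linear extension is a total order $L$ on $S$ with $x\le_P y\Rightarrow x\le_L y$; a realizer is a set of linear extensions such that for every incomparable pair $x,y$ there are extensions $L_i,L_j$ in the set with $x<_{L_i}y$ and $y<_{L_j}x$; $\dim(P)$ is the minimum size of a realizer. *)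

theory Defs
  imports Complex_Main "Graph_Theory.Pair_Digraph"
begin

text \<open>
  A finite simple undirected graph is a \<^locale>\<open>pair_graph\<close>: a finite, loop-free digraph without
  parallel arcs whose arc relation is symmetric; the edge \<open>uv\<close> is the pair of arcs
  \<open>(u, v)\<close>, \<open>(v, u)\<close>.
\<close>

definition neighbours :: "'a \<Rightarrow> 'a pair_pre_digraph \<Rightarrow> 'a set" where
  "neighbours u G = {v. (u, v) \<in> parcs G}"

definition graph_complement :: "'a pair_pre_digraph \<Rightarrow> 'a pair_pre_digraph" where
  "graph_complement G =
     \<lparr> pverts = pverts G,
       parcs = {(u, v). u \<in> pverts G \<and> v \<in> pverts G \<and> u \<noteq> v \<and> (u, v) \<notin> parcs G} \<rparr>"

definition clique :: "'a pair_pre_digraph \<Rightarrow> 'a set \<Rightarrow> bool" where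
  "clique G C \<longleftrightarrow> C \<subseteq> pverts G \<and> (\<forall>u\<in>C. \<forall>v\<in>C. u \<noteq> v \<longrightarrow> (u, v) \<in> parcs G)"

definition independent_set :: "'a pair_pre_digraph \<Rightarrow> 'a set \<Rightarrow> bool" where
  "independent_set G I \<longleftrightarrow> I \<subseteq> pverts G \<and> (\<forall>u\<in>I. \<forall>v\<in>I. (u, v) \<notin> parcs G)"

text \<open>Either part of the partition may be empty.\<close>

definition split_partition :: "'a pair_pre_digraph \<Rightarrow> 'a set \<Rightarrow> 'a set \<Rightarrow> bool" where
  "split_partition G C I \<longleftrightarrow>
     C \<union> I = pverts G \<and> C \<inter> I = {} \<and> clique G C \<and> independent_set G I"

definition characteristic_sets :: "'a pair_pre_digraph \<Rightarrow> 'a set \<Rightarrow> 'a set set" where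
  "characteristic_sets G I = {neighbours u G | u. u \<in> I}"

definition characteristic_order :: "'a pair_pre_digraph \<Rightarrow> 'a set \<Rightarrow> 'a set rel" where
  "characteristic_order G I = relation_of (\<subseteq>) (characteristic_sets G I)"

definition threshold_graph :: "'a pair_pre_digraph \<Rightarrow> bool" where
  "threshold_graph G \<longleftrightarrow> pair_graph G \<and>
     (\<exists>(S :: real) (w :: 'a \<Rightarrow> real). \<forall>u\<in>pverts G. \<forall>v\<in>pverts G.
        u \<noteq> v \<longrightarrow> ((u, v) \<in> parcs G \<longleftrightarrow> w u + w v \<ge> S))"

definition threshold_cover ::
    "'a pair_pre_digraph \<Rightarrow> nat \<Rightarrow> (nat \<Rightarrow> 'a pair_pre_digraph) \<Rightarrow> bool" where
  "threshold_cover G k H \<longleftrightarrow>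
     (\<forall>i<k. threshold_graph (H i) \<and> pverts (H i) = pverts G) \<and>
     parcs G = (\<Union>i<k. parcs (H i))"

text \<open>An edgeless graph is covered by the empty family, so its threshold dimension is \<open>0\<close>.\<close>

definition threshold_dimension :: "'a pair_pre_digraph \<Rightarrow> nat" where
  "threshold_dimension G = (LEAST k. \<exists>H. threshold_cover G k H)"

definition linear_extension :: "'a set \<Rightarrow> 'a rel \<Rightarrow> 'a rel \<Rightarrow> bool" where
  "linear_extension S r L \<longleftrightarrow> linear_order_on S L \<and> r \<subseteq> L"

definition incomparable :: "'a set \<Rightarrow> 'a rel \<Rightarrow> 'a \<Rightarrow> 'a \<Rightarrow> bool" where
  "incomparable S r x y \<longleftrightarrow> x \<in> S \<and> y \<in> S \<and> (x, y) \<notin> r \<and> (y, x) \<notin> r"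

text \<open>
  In the next definition \<open>x \<noteq> y\<close> is automatic for incomparable elements of a poset, so membership
  in \<open>L\<^sub>i\<close> is the strict relation \<open>x < y\<close>.
\<close>

definition realizer :: "'a set \<Rightarrow> 'a rel \<Rightarrow> 'a rel set \<Rightarrow> bool" where
  "realizer S r R \<longleftrightarrow>
     (\<forall>L\<in>R. linear_extension S r L) \<and>
     (\<forall>x y. incomparable S r x y \<longrightarrow> (\<exists>L\<^sub>i\<in>R. \<exists>L\<^sub>j\<in>R. (x, y) \<in> L\<^sub>i \<and> (y, x) \<in> L\<^sub>j))"

text \<open>
  The empty set is a realizer of a chain, so a chain has dimension \<open>0\<close>. Finiteness is required
  since \<^const>\<open>card\<close> is \<open>0\<close> on infinite sets.
\<close>

definition poset_dimension :: "'a set \<Rightarrow> 'a rel \<Rightarrow> nat" where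
  "poset_dimension S r = (LEAST k. \<exists>R. finite R \<and> card R = k \<and> realizer S r R)"

end

theory Submission
  imports Defs
begin

text \<open>
  Cover the complement by threshold graphs with weights \<open>w\<^sub>i\<close>. For a characteristic set \<open>X\<close> let
  \<open>f\<^sub>i X\<close> be the largest weight \<open>w\<^sub>i u\<close> over all \<open>u \<in> I\<close> with \<open>X \<subseteq> N(u)\<close>; this is antitone
  in \<open>X\<close>. If \<open>c \<in> N(x) - N(y)\<close>, some threshold graph contains the edge \<open>yc\<close>, and there
  \<open>f\<^sub>i (N(x)) < w\<^sub>i y \<le> f\<^sub>i (N(y))\<close>: a vertex \<open>u\<close> with \<open>N(x) \<subseteq> N(u)\<close> and \<open>w\<^sub>i u \<ge> w\<^sub>i y\<close>
  would be joined to \<open>c\<close> in the complement. So sorting by decreasing \<open>f\<^sub>i\<close>, with ties broken by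
  a linear extension of inclusion, yields one linear extension per threshold graph, and these form
  a realizer.
\<close>

text \<open>Order lexicographically by \<open>f\<close>, then by cardinality, then by an arbitrary
  injective numbering \<open>g\<close>. When \<open>f\<close> ties, a proper subset still has
  smaller cardinality because the sets are finite, so inclusion is respected; \<open>g\<close>
  settles what remains and gives antisymmetry.\<close>

lemma linear_extension_sorted_by_key:
  fixes S :: "'a set set" and f :: "'a set \<Rightarrow> real"
  assumes fin: "finite S" "\<And>X. X \<in> S \<Longrightarrow> finite X"
    and mono: "\<And>X Y. X \<in> S \<Longrightarrow> Y \<in> S \<Longrightarrow> X \<subseteq> Y \<Longrightarrow> f X \<le> f Y"
  shows "\<exists>L. linear_extension S (relation_of (\<subseteq>) S) L \<and>
             (\<forall>X\<in>S. \<forall>Y\<in>S. f X < f Y \<longrightarrow> (X, Y) \<in> L)"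
proof -
  obtain g :: "'a set \<Rightarrow> nat" where g: "inj_on g S"
    using finite_imp_inj_to_nat_seg[OF fin(1)] by blast
  define L where "L = {(X, Y). X \<in> S \<and> Y \<in> S \<and>
    (f X < f Y \<or> f X = f Y \<and> (card X < card Y \<or> card X = card Y \<and> g X \<le> g Y))}"
  have "linear_order_on S L"
    unfolding linear_order_on_def partial_order_on_def preorder_on_def
  proof (intro conjI)
    show "L \<subseteq> S \<times> S" "refl_on S L" "total_on S L"
      by (auto simp: L_def refl_on_def total_on_def)
    show "trans L"
      by (rule transI) (auto simp: L_def)
    show "antisym L"
      using g by (intro antisymI) (auto simp: L_def dest: inj_onD)
  qed
  moreover have "(X, Y) \<in> L" if "X \<in> S" "Y \<in> S" "X \<subseteq> Y" for X Y
  proof (cases "X = Y")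
    case False
    then have "card X < card Y"
      using that fin(2) by (simp add: psubset_card_mono)
    then show ?thesis
      using mono[OF that] that by (auto simp: L_def)
  qed (use that in \<open>simp add: L_def\<close>)
  ultimately show ?thesis
    by (intro exI[of _ L]) (auto simp: linear_extension_def relation_of_def L_def)
qed

text \<open>Weight 1 on both ends, 0 elsewhere and threshold 2: only the pair of the two ends
  reaches it.\<close>

lemma threshold_graph_single_edge:
  fixes V :: "'a set"
  assumes "finite V" "a \<in> V" "b \<in> V" "a \<noteq> b"
  shows "threshold_graph \<lparr>pverts = V, parcs = {(a, b), (b, a)}\<rparr>" (is "threshold_graph ?H")
  unfolding threshold_graph_def
proof (intro conjI exI ballI impI)
  show "pair_graph ?H"
    using assms by unfold_locales (auto simp: sym_def symmetric_def)
  fix u v :: 'a assume "u \<noteq> v"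
  then show "(u, v) \<in> parcs ?H \<longleftrightarrow>
      2 \<le> (if u \<in> {a, b} then 1 else 0) + (if v \<in> {a, b} then 1 else 0 :: real)"
    by auto
qed

text \<open>Guarantees that the \<open>LEAST\<close> in \<open>threshold_dimension\<close> is
  attained. One single-edge graph per listed arc is enough; an edge may be listed in both
  orientations, as no minimality is claimed.\<close>

lemma threshold_cover_exists:
  assumes "pair_graph G"
  shows "\<exists>k H. threshold_cover G k H"
proof -
  interpret pair_graph G by fact
  obtain es where es: "set es = parcs G"
    using finite_list[OF pair_finite_arcs] by blast
  define H where "H i = \<lparr>pverts = pverts G,
    parcs = {es ! i, (snd (es ! i), fst (es ! i))}\<rparr>" for i
  have "threshold_graph (H i)" if "i < length es" for i
  proof -
    obtain a b where ab: "es ! i = (a, b)" by force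
    then have "(a, b) \<in> parcs G" using es that nth_mem by metis
    then have "a \<in> pverts G" "b \<in> pverts G" "a \<noteq> b"
      using in_arcsD1 in_arcsD2 pair_no_loops by fastforce+
    then show ?thesis
      using threshold_graph_single_edge[OF pair_finite_verts] by (simp add: H_def ab)
  qed
  moreover have "parcs G = (\<Union>i<length es. parcs (H i))"
  proof
    have "\<exists>i<length es. e \<in> parcs (H i)" if "e \<in> parcs G" for e
      using that unfolding es[symmetric] in_set_conv_nth H_def by auto
    then show "parcs G \<subseteq> (\<Union>i<length es. parcs (H i))"
      by blast
    have "(b, a) \<in> parcs G" if "(a, b) \<in> parcs G" for a b
      using that arcs_symmetric by blast
    moreover have "(fst (es ! i), snd (es ! i)) \<in> parcs G" if "i < length es" for i
      using that es by auto
    ultimately show "(\<Union>i<length es. parcs (H i)) \<subseteq> parcs G"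
      by (auto simp: H_def)
  qed
  ultimately have "threshold_cover G (length es) H"
    by (simp add: threshold_cover_def H_def)
  then show ?thesis by blast
qed

lemma pair_graph_graph_complement:
  assumes "pair_graph G"
  shows "pair_graph (graph_complement G)"
proof -
  interpret pair_graph G by fact
  have "parcs (graph_complement G) \<subseteq> pverts G \<times> pverts G"
    by (auto simp: graph_complement_def)
  then have "finite (parcs (graph_complement G))"
    by (rule finite_subset) simp
  then show ?thesis
    by unfold_locales
       (auto simp: graph_complement_def symmetric_def sym_def intro: arcs_symmetric)
qed

text \<open>The bound on \<open>card R\<close> is an inequality because different members of the
  cover may induce the same linear extension.\<close>

lemma realizer_of_threshold_cover:
  assumes "pair_graph G" and split: "split_partition G C I"
    and cover: "threshold_cover (graph_complement G) k H"
  shows "\<exists>R. finite R \<and> card R \<le> k \<and>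
             realizer (characteristic_sets G I) (characteristic_order G I) R"
proof -
  interpret pair_graph G by fact
  let ?S = "characteristic_sets G I"
  let ?N = "\<lambda>u. neighbours u G"
  have I: "I \<subseteq> pverts G" "finite I" and C: "C \<subseteq> pverts G" and disj: "C \<inter> I = {}"
    using split finite_subset[OF _ pair_finite_verts] by (auto simp: split_partition_def)
  have nbC: "?N u \<subseteq> C" if "u \<in> I" for u
    using split that in_arcsD2
    by (fastforce simp: split_partition_def independent_set_def neighbours_def)
  have "finite C"
    using C finite_subset pair_finite_verts by blast
  then have finX: "finite X" if "X \<in> ?S" for X
    using that nbC by (auto simp: characteristic_sets_def intro: finite_subset)
  have finS: "finite ?S"
    using I by (auto simp: characteristic_sets_def)
  have "\<forall>i<k. \<exists>T w. \<forall>u\<in>pverts G. \<forall>v\<in>pverts G. u \<noteq> v \<longrightarrow>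
      ((u, v) \<in> parcs (H i) \<longleftrightarrow> w u + w v \<ge> (T :: real))"
    using cover unfolding threshold_cover_def threshold_graph_def graph_complement_def by fastforce
  then obtain T :: "nat \<Rightarrow> real" and w
    where w: "\<And>i u v. \<lbrakk>i < k; u \<in> pverts G; v \<in> pverts G; u \<noteq> v\<rbrakk> \<Longrightarrow>
      (u, v) \<in> parcs (H i) \<longleftrightarrow> w i u + w i v \<ge> T i"
    by metis
  \<comment> \<open>Disjointness of \<open>C\<close> and \<open>I\<close> makes \<open>u\<close> and
    \<open>c\<close> distinct, so a non-edge between them is an edge of the complement and lies in
    some \<open>H i\<close>.\<close>
  have nonedge: "c \<notin> ?N u \<longleftrightarrow> (\<exists>i<k. w i u + w i c \<ge> T i)" if "u \<in> I" "c \<in> C" for u c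
  proof -
    have *: "u \<in> pverts G" "c \<in> pverts G" "u \<noteq> c" using that I C disj by auto
    then have "c \<notin> ?N u \<longleftrightarrow> (u, c) \<in> parcs (graph_complement G)"
      by (auto simp: neighbours_def graph_complement_def)
    also have "\<dots> \<longleftrightarrow> (\<exists>i<k. (u, c) \<in> parcs (H i))"
      using cover by (auto simp: threshold_cover_def)
    finally show ?thesis using w * by auto
  qed
  define f where "f i X = Max (w i ` {u \<in> I. X \<subseteq> ?N u})" for i X
  have f_ge: "w i u \<le> f i X" if "u \<in> I" "X \<subseteq> ?N u" for i u X
    unfolding f_def using that I by (intro Max_ge) auto
  \<comment> \<open>If \<open>X\<close> is the neighbourhood of \<open>v \<in> I\<close>, then
    \<open>v\<close> itself is a candidate, so the maximum is over a nonempty set.\<close>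
  have f_attained: "\<exists>u\<in>I. X \<subseteq> ?N u \<and> f i X = w i u" if "X \<in> ?S" for i X
  proof -
    have "f i X \<in> w i ` {u \<in> I. X \<subseteq> ?N u}"
      unfolding f_def using that I by (intro Max_in) (auto simp: characteristic_sets_def)
    then show ?thesis by auto
  qed
  \<comment> \<open>A maximiser for \<open>Y\<close> is also a candidate for \<open>X\<close>; the
    sign turns the antitone \<open>f i\<close> into a monotone key.\<close>
  have "- f i X \<le> - f i Y" if "X \<in> ?S" "Y \<in> ?S" "X \<subseteq> Y" for i X Y
    using f_attained[OF that(2)] f_ge that(3) by (metis neg_le_iff_le order_trans)
  then have "\<exists>L. linear_extension ?S (characteristic_order G I) L \<and>
      (\<forall>X\<in>?S. \<forall>Y\<in>?S. - f i X < - f i Y \<longrightarrow> (X, Y) \<in> L)" for i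
    unfolding characteristic_order_def
    by (intro linear_extension_sorted_by_key finS finX)
  then obtain L where ext: "\<And>i. linear_extension ?S (characteristic_order G I) (L i)"
    and sorted: "\<And>i X Y. \<lbrakk>X \<in> ?S; Y \<in> ?S; f i Y < f i X\<rbrakk> \<Longrightarrow> (X, Y) \<in> L i"
    by (metis neg_less_iff_less)
  \<comment> \<open>Non-inclusion in one direction yields one of the two extensions needed; an
    incomparable pair uses this twice.\<close>
  have separated: "\<exists>i<k. (Y, X) \<in> L i" if XY: "X \<in> ?S" "Y \<in> ?S" "\<not> X \<subseteq> Y" for X Y
  proof -
    obtain c where c: "c \<in> X" "c \<notin> Y" using \<open>\<not> X \<subseteq> Y\<close> by blast
    obtain v where v: "v \<in> I" "Y = ?N v"
      using XY(2) by (auto simp: characteristic_sets_def)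
    have "c \<in> C" using c(1) XY(1) nbC by (auto simp: characteristic_sets_def)
    then obtain i where i: "i < k" "w i v + w i c \<ge> T i"
      using nonedge v c(2) by blast
    obtain u where u: "u \<in> I" "X \<subseteq> ?N u" "f i X = w i u"
      using f_attained[OF XY(1)] by blast
    \<comment> \<open>Here \<open>c\<close> is a neighbour of \<open>u\<close>, so
      \<open>nonedge\<close> excludes every index, in particular the \<open>i\<close> chosen for
      \<open>v\<close>.\<close>
    have "\<not> w i u + w i c \<ge> T i"
      using nonedge[OF u(1) \<open>c \<in> C\<close>] u(2) c(1) i(1) by blast
    then have "f i X < w i v" using i(2) u(3) by linarith
    also have "\<dots> \<le> f i Y" using f_ge v by simp
    finally show ?thesis using sorted XY i(1) by blast
  qed
  have "realizer ?S (characteristic_order G I) (L ` {..<k})"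
    unfolding realizer_def
  proof (intro conjI allI impI)
    fix X Y assume "incomparable ?S (characteristic_order G I) X Y"
    then have *: "X \<in> ?S" "Y \<in> ?S" "\<not> X \<subseteq> Y" "\<not> Y \<subseteq> X"
      by (auto simp: incomparable_def characteristic_order_def relation_of_def)
    show "\<exists>L\<^sub>i\<in>L ` {..<k}. \<exists>L\<^sub>j\<in>L ` {..<k}. (X, Y) \<in> L\<^sub>i \<and> (Y, X) \<in> L\<^sub>j"
      using separated[OF *(1,2,3)] separated[OF *(2,1,4)] by blast
  qed (use ext in auto)
  moreover have "card (L ` {..<k}) \<le> k"
    using card_image_le[of "{..<k}" L] by simp
  ultimately show ?thesis by blast
qed

theorem theorem2:
  fixes G :: "'a pair_pre_digraph" and C I :: "'a set"
  assumes "pair_graph G"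
    and "split_partition G C I"
  shows "poset_dimension (characteristic_sets G I) (characteristic_order G I)
           \<le> threshold_dimension (graph_complement G)"
proof -
  have "\<exists>H. threshold_cover (graph_complement G) (threshold_dimension (graph_complement G)) H"
    unfolding threshold_dimension_def
    using threshold_cover_exists[OF pair_graph_graph_complement[OF assms(1)]] by (rule LeastI_ex)
  then obtain R where R: "finite R" "card R \<le> threshold_dimension (graph_complement G)"
      "realizer (characteristic_sets G I) (characteristic_order G I) R"
    using realizer_of_threshold_cover[OF assms] by blast
  have "poset_dimension (characteristic_sets G I) (characteristic_order G I) \<le> card R"
    unfolding poset_dimension_def using R by (intro Least_le) blast
  then show ?thesis using R(2) by linarith
qed

end
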